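(* Let $S, T, U$ be pairwise disjoint finite index sets and consider, for $A \in \mathbb{Z}^{M \times S}$ and $c \in \mathbb{Z}^{M}$, the rational polyhedron \[ P = \{ (x,y,z) \in \mathbb{R}^S \times \mathbb{R}^T \times \mathbb{R}^U \mid Ax + By = c,~ Dx + Ey + F z \leq g \}. \] If $B$ is unimodular and has full column rank, then $y$ is implied fixed integer by $x$ for $P$.
   Context: A matrix $B \in \mathbb{Z}^{M \times T}$ of rank $r$ is unimodular if for every submatrix consisting of $r$ linearly independent columns of $B$, the greatest common divisor of its subdeterminants of order $r$ equals $1$. For $\bar{x} \in \mathbb{Z}^S$, the fiber is $Q_S(\bar{x}) \coloneqq \{ (x,y,z) \in P \mid x = \bar{x} \}$. "$y$ is implied fixed integer by $x$ for $P$" means: for each $\bar{x} \in \mathbb{Z}^S$, the projection of $Q_S(\bar{x})$ onto the $y$-coordinates is either empty or consists of a single vector, which is integral. *)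

theory Defs
  imports
    "Jordan_Normal_Form.DL_Rank"
    "Jordan_Normal_Form.DL_Submatrix"
    "Jordan_Normal_Form.Determinant"
begin

text \<open>
  The finite index sets \<open>M\<close>, \<open>S\<close>, \<open>T\<close>, \<open>U\<close> are represented by initial segments
  of the natural numbers, possibly empty. Disjointness of \<open>S\<close>, \<open>T\<close>, \<open>U\<close> is reflected
  by keeping the three blocks of variables as separate components of a triple.
\<close>

definition real_rank :: "int mat \<Rightarrow> nat" where
  "real_rank B = vec_space.rank (dim_row B) (map_mat real_of_int B)"

text \<open>The columns are independent as a family; distinctness excludes repeated columns,
  which \<open>lin_dep\<close>, being a property of sets, would not detect.\<close>

definition lin_indpt_cols :: "int mat \<Rightarrow> bool" where
  "lin_indpt_cols C \<longleftrightarrow>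
     (let cs = cols (map_mat real_of_int C) in
        distinct cs \<and>
        \<not> LinearCombinations.module.lin_dep class_ring (module_vec TYPE(real) (dim_row C)) (set cs))"

definition subdeterminants :: "nat \<Rightarrow> int mat \<Rightarrow> int set" where
  "subdeterminants k C =
     {det (submatrix C I J) | I J.
        I \<subseteq> {..<dim_row C} \<and> card I = k \<and> J \<subseteq> {..<dim_col C} \<and> card J = k}"

definition unimodular :: "int mat \<Rightarrow> bool" where
  "unimodular B \<longleftrightarrow>
     (\<forall>J. J \<subseteq> {..<dim_col B} \<and> card J = real_rank B \<and> lin_indpt_cols (submatrix B UNIV J) \<longrightarrow>
        Gcd (subdeterminants (real_rank B) (submatrix B UNIV J)) = 1)"

definition full_column_rank :: "int mat \<Rightarrow> bool" where
  "full_column_rank B \<longleftrightarrow> real_rank B = dim_col B"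

definition mixed_polyhedron ::
  "int mat \<Rightarrow> int mat \<Rightarrow> int vec \<Rightarrow> rat mat \<Rightarrow> rat mat \<Rightarrow> rat mat \<Rightarrow> rat vec \<Rightarrow>
     (real vec \<times> real vec \<times> real vec) set" where
  "mixed_polyhedron A B c D E F g =
     {(x, y, z). x \<in> carrier_vec (dim_col A) \<and> y \<in> carrier_vec (dim_col B) \<and> z \<in> carrier_vec (dim_col F) \<and>
        map_mat real_of_int A *\<^sub>v x + map_mat real_of_int B *\<^sub>v y = map_vec real_of_int c \<and>
        map_mat real_of_rat D *\<^sub>v x + map_mat real_of_rat E *\<^sub>v y + map_mat real_of_rat F *\<^sub>v z
          \<le> map_vec real_of_rat g}"

definition fiber :: "('a vec \<times> 'b \<times> 'c) set \<Rightarrow> 'a vec \<Rightarrow> ('a vec \<times> 'b \<times> 'c) set" where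
  "fiber P xbar = {(x, y, z). (x, y, z) \<in> P \<and> x = xbar}"

text \<open>The parameter \<open>s\<close> is the number of \<open>x\<close>-coordinates.\<close>

definition implied_fixed_integer :: "nat \<Rightarrow> (real vec \<times> real vec \<times> 'c) set \<Rightarrow> bool" where
  "implied_fixed_integer s P \<longleftrightarrow>
     (\<forall>xbar :: int vec. xbar \<in> carrier_vec s \<longrightarrow>
        (let Y = (\<lambda>(x, y, z). y) ` fiber P (map_vec real_of_int xbar) in
           Y = {} \<or> (\<exists>y. Y = {y} \<and> (\<forall>i < dim_vec y. y $ i \<in> \<int>))))"

end

theory Submission
  imports Defs "HOL-Computational_Algebra.Group_Closure"
begin

text \<open>
  Put \<open>w = c - A x\<close>, an integral vector if \<open>x\<close> is integral. Any two solutions \<open>y\<close> of \<open>B y = w\<close>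
  coincide because \<open>B\<close> has full column rank. For every maximal square submatrix \<open>N\<close> of \<open>B\<close>,
  multiplying the corresponding rows of \<open>B y = w\<close> by the adjugate of \<open>N\<close> shows that \<open>det N \<cdot> y\<close>
  is integral. The integers \<open>d\<close> with \<open>d \<cdot> y\<close> integral form a subgroup, which therefore
  contains the greatest common divisor \<open>1\<close> of these determinants.
\<close>

text \<open>The rank is the size of a maximal independent subset of the set of columns, so a
  repeated column would push it below \<open>nc\<close>.\<close>

lemma (in vec_space) full_rank_distinct_cols:
  assumes A: "A \<in> carrier_mat n nc" and rank: "rank A = nc"
  shows "distinct (cols A)"
proof -
  obtain S where S: "maximal S (\<lambda>T. T \<subseteq> set (cols A) \<and> lin_indpt T)"
    using maximal_exists[of "\<lambda>T. T \<subseteq> set (cols A) \<and> lin_indpt T" "card (set (cols A))" "{}"]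
    by (meson List.finite_set card_mono empty_iff empty_subsetI finite_lin_indpt2 rev_finite_subset)
  have "nc = card S" using rank_card_indpt[OF A S] rank by simp
  also have "\<dots> \<le> card (set (cols A))" using S by (simp add: card_mono maximal_def)
  finally have "length (cols A) \<le> card (set (cols A))" using A by simp
  then show ?thesis using card_distinct card_length le_antisym by blast
qed

lemma pick_lessThan: "j < t \<Longrightarrow> pick {..<t} j = j"
  using pick_reduce_set[of j t UNIV] by (simp add: pick_UNIV lessThan_def)

text \<open>Identifies \<open>B\<close> with one of the column submatrices over which
  \<open>unimodular\<close> quantifies.\<close>

lemma submatrix_all_cols: "submatrix B UNIV {..<dim_col B} = B"
  by (rule eq_matI) (simp_all add: submatrix_def pick_UNIV pick_lessThan)

lemma full_column_rank_imp_lin_indpt_cols: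
  assumes "full_column_rank B"
  shows "lin_indpt_cols B"
proof -
  interpret vec_space "TYPE(real)" "dim_row B" .
  let ?B = "map_mat real_of_int B"
  have B: "?B \<in> carrier_mat (dim_row B) (dim_col B)" by simp
  have rank: "rank ?B = dim_col B"
    using assms by (simp add: full_column_rank_def real_rank_def)
  show ?thesis
    using full_rank_distinct_cols[OF B rank] full_rank_lin_indpt[OF B rank]
    by (simp add: lin_indpt_cols_def)
qed

text \<open>Otherwise \<open>v - w\<close> would be a nonzero kernel vector of \<open>B\<close>, and
  its entries would be the coefficients of a linear dependence among the columns.\<close>

lemma full_column_rank_mult_inj:
  assumes fcr: "full_column_rank B"
    and v: "v \<in> carrier_vec (dim_col B)" and w: "w \<in> carrier_vec (dim_col B)"
    and eq: "map_mat real_of_int B *\<^sub>v v = map_mat real_of_int B *\<^sub>v w"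
  shows "v = w"
proof (rule ccontr)
  interpret vec_space "TYPE(real)" "dim_row B" .
  let ?B = "map_mat real_of_int B"
  have B: "?B \<in> carrier_mat (dim_row B) (dim_col B)" by simp
  assume "v \<noteq> w"
  have ne: "v - w \<noteq> 0\<^sub>v (dim_col B)"
  proof
    assume diff: "v - w = 0\<^sub>v (dim_col B)"
    have "v $ i = w $ i" if "i < dim_col B" for i
      using arg_cong[OF diff, of "\<lambda>x. x $ i"] that v w by simp
    then show False using \<open>v \<noteq> w\<close> v w by auto
  qed
  have "?B *\<^sub>v (v - w) = ?B *\<^sub>v v - ?B *\<^sub>v w"
    using mult_minus_distrib_mat_vec[OF B v w] .
  also have "\<dots> = 0\<^sub>v (dim_row B)" using eq by auto
  finally have zero: "?B *\<^sub>v (v - w) = 0\<^sub>v (dim_row B)" .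
  have "v - w \<in> carrier_vec (dim_col B)" using v w by simp
  then show False
    using lin_depI[OF B _ ne zero] full_column_rank_imp_lin_indpt_cols[OF fcr]
    by (simp add: lin_indpt_cols_def Let_def)
qed

lemma Ints_mult_mat_vec:
  fixes M :: "int mat" and v :: "real vec"
  assumes "dim_vec v = dim_col M" and "\<And>j. j < dim_vec v \<Longrightarrow> v $ j \<in> \<int>" and "i < dim_row M"
  shows "(map_mat real_of_int M *\<^sub>v v) $ i \<in> \<int>"
  using assms by (auto simp: scalar_prod_def intro!: Ints_sum Ints_mult)

lemma Ints_subdeterminant_mult:
  fixes B :: "int mat" and v :: "real vec"
  assumes v: "v \<in> carrier_vec (dim_col B)"
    and Bv: "\<And>i. i < dim_row B \<Longrightarrow> (map_mat real_of_int B *\<^sub>v v) $ i \<in> \<int>"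
    and d: "d \<in> subdeterminants (dim_col B) B"
    and i: "i < dim_col B"
  shows "real_of_int d * v $ i \<in> \<int>"
proof -
  let ?t = "dim_col B"
  obtain I J where dN: "d = det (submatrix B I J)" and I: "I \<subseteq> {..<dim_row B}" "card I = ?t"
    and J: "J \<subseteq> {..<?t}" "card J = ?t"
    using d by (auto simp: subdeterminants_def)
  \<comment> \<open>Minors of order \<open>dim_col B\<close> use every column, so only the choice of
    rows \<open>I\<close> is free.\<close>
  have J_eq: "J = {..<?t}" using J by (simp add: card_subset_eq)
  define N where "N = submatrix B I J"
  let ?N = "map_mat real_of_int N" and ?adj = "map_mat real_of_int (adj_mat N)"
  have rows: "{i. i < dim_row B \<and> i \<in> I} = I" using I by auto
  have N: "N \<in> carrier_mat ?t ?t"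
    using I by (auto simp: N_def J_eq submatrix_def rows)
  have Nv_Ints: "(?N *\<^sub>v v) $ k \<in> \<int>" if k: "k < ?t" for k
  proof -
    have pick: "pick I k < dim_row B"
      using pick_le[of k "dim_row B" I] k I by (simp add: rows)
    \<comment> \<open>\<open>N\<close> consists of the rows of \<open>B\<close> selected by
      \<open>I\<close>, so \<open>N v\<close> is a subvector of \<open>B v\<close> and inherits its
      integrality.\<close>
    have "row ?N k = row (map_mat real_of_int B) (pick I k)"
    proof (rule eq_vecI)
      fix j assume "j < dim_vec (row (map_mat real_of_int B) (pick I k))"
      then show "row ?N k $ j = row (map_mat real_of_int B) (pick I k) $ j"
        using k N pick I by (simp add: N_def J_eq submatrix_def rows pick_lessThan)
    qed (use N in simp)
    then have "(?N *\<^sub>v v) $ k = (map_mat real_of_int B *\<^sub>v v) $ pick I k"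
      using k N pick by simp
    then show ?thesis using Bv[OF pick] by simp
  qed
  \<comment> \<open>The identity \<open>adj N * N = det N * 1\<close> also covers singular
    \<open>N\<close>, and the adjugate of an integer matrix is again an integer matrix, unlike the
    inverse.\<close>
  have "?adj *\<^sub>v (?N *\<^sub>v v) = (?adj * ?N) *\<^sub>v v"
    using adj_mat(1)[OF N] N v by (intro assoc_mult_mat_vec[symmetric]) auto
  also have "?adj * ?N = map_mat real_of_int (det N \<cdot>\<^sub>m 1\<^sub>m ?t)"
    using of_int_hom.mat_hom_mult[OF adj_mat(1)[OF N] N, where ?'a = real] adj_mat(3)[OF N] by simp
  also have "\<dots> = real_of_int (det N) \<cdot>\<^sub>m 1\<^sub>m ?t"
    by (rule eq_matI) auto
  also have "\<dots> *\<^sub>v v = real_of_int d \<cdot>\<^sub>v v"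
    using v by (intro eq_vecI) (simp_all add: dN N_def)
  finally have "real_of_int d * v $ i = (?adj *\<^sub>v (?N *\<^sub>v v)) $ i"
    using i v by simp
  also have "\<dots> \<in> \<int>"
    by (rule Ints_mult_mat_vec) (use adj_mat(1)[OF N] N i Nv_Ints in auto)
  finally show ?thesis .
qed

text \<open>Bezout's identity: \<open>Gcd S\<close> lies in the additive group generated by
  \<open>S\<close>, and integrality of \<open>d * r\<close> is preserved under differences in
  \<open>d\<close>.\<close>

lemma Ints_Gcd_mult:
  fixes S :: "int set" and r :: real
  assumes "\<And>d. d \<in> S \<Longrightarrow> real_of_int d * r \<in> \<int>"
  shows "real_of_int (Gcd S) * r \<in> \<int>"
proof -
  have "real_of_int d * r \<in> \<int>" if "d \<in> group_closure S" for d
    using that by induction (auto simp: left_diff_distrib assms)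
  then show ?thesis using Gcd_in_group_closure by blast
qed

lemma unimodular_solution_Ints:
  fixes B :: "int mat" and v :: "real vec"
  assumes uni: "unimodular B" and fcr: "full_column_rank B"
    and v: "v \<in> carrier_vec (dim_col B)"
    and Bv: "\<And>i. i < dim_row B \<Longrightarrow> (map_mat real_of_int B *\<^sub>v v) $ i \<in> \<int>"
    and i: "i < dim_col B"
  shows "v $ i \<in> \<int>"
proof -
  \<comment> \<open>Under full column rank the set of all columns has size
    \<open>real_rank B\<close> and is independent, so unimodularity applies to
    \<open>J = {..<dim_col B}\<close>.\<close>
  have "Gcd (subdeterminants (dim_col B) B) = 1"
    using uni fcr full_column_rank_imp_lin_indpt_cols[OF fcr]
    unfolding unimodular_def full_column_rank_def
    by (metis card_lessThan order_refl submatrix_all_cols)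
  then show ?thesis
    using Ints_Gcd_mult[of "subdeterminants (dim_col B) B" "v $ i"]
      Ints_subdeterminant_mult[OF v Bv _ i] by simp
qed

theorem theorem18:
  fixes m k s t u :: nat
    and A B :: "int mat" and c :: "int vec"
    and D E F :: "rat mat" and g :: "rat vec"
  assumes "A \<in> carrier_mat m s" and "B \<in> carrier_mat m t" and "c \<in> carrier_vec m"
    and "D \<in> carrier_mat k s" and "E \<in> carrier_mat k t" and "F \<in> carrier_mat k u"
    and "g \<in> carrier_vec k"
    and "unimodular B" and "full_column_rank B"
  shows "implied_fixed_integer s (mixed_polyhedron A B c D E F g)"
proof -
  let ?A = "map_mat real_of_int A" and ?B = "map_mat real_of_int B"
  have fixed: "Y = {} \<or> (\<exists>y. Y = {y} \<and> (\<forall>i < dim_vec y. y $ i \<in> \<int>))"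
    if xbar: "xbar \<in> carrier_vec s"
      and Y: "Y = (\<lambda>(x, y, z). y) ` fiber (mixed_polyhedron A B c D E F g) (map_vec real_of_int xbar)"
    for xbar :: "int vec" and Y
  proof -
    let ?x = "map_vec real_of_int xbar"
    have Y_D: "y \<in> carrier_vec (dim_col B)" "?A *\<^sub>v ?x + ?B *\<^sub>v y = map_vec real_of_int c"
      if "y \<in> Y" for y
      using that by (auto simp: Y fiber_def mixed_polyhedron_def)
    \<comment> \<open>The right-hand side is free of \<open>y\<close>. Hence all elements of
      \<open>Y\<close> have the same image under \<open>B\<close>, and that image is integral
      because \<open>A\<close>, \<open>xbar\<close> and \<open>c\<close> are.\<close>
    have By: "(?B *\<^sub>v y) $ i = real_of_int (c $ i) - (?A *\<^sub>v ?x) $ i"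
      if y: "y \<in> Y" and i: "i < dim_row B" for y i
    proof -
      have "(?A *\<^sub>v ?x + ?B *\<^sub>v y) $ i = map_vec real_of_int c $ i"
        using Y_D(2)[OF y] by simp
      moreover have "(?A *\<^sub>v ?x + ?B *\<^sub>v y) $ i = (?A *\<^sub>v ?x) $ i + (?B *\<^sub>v y) $ i"
        using i by (intro index_add_vec) simp
      moreover have "map_vec real_of_int c $ i = real_of_int (c $ i)"
        using i assms(2,3) by simp
      ultimately show ?thesis by linarith
    qed
    have unique: "y = y'" if "y \<in> Y" "y' \<in> Y" for y y'
    proof (rule full_column_rank_mult_inj[OF assms(9)])
      show "?B *\<^sub>v y = ?B *\<^sub>v y'"
        by (rule eq_vecI) (simp_all add: By that del: index_mult_mat_vec)
    qed (use that Y_D in auto)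
    have Ints: "y $ i \<in> \<int>" if y: "y \<in> Y" and i: "i < dim_vec y" for y i
    proof (rule unimodular_solution_Ints[OF assms(8,9) Y_D(1)[OF y]])
      fix j assume j: "j < dim_row B"
      have "(?A *\<^sub>v ?x) $ j \<in> \<int>"
        by (rule Ints_mult_mat_vec) (use j assms(1,2) xbar in auto)
      then show "(?B *\<^sub>v y) $ j \<in> \<int>" using By[OF y j] by simp
    qed (use i Y_D(1)[OF y] in auto)
    show ?thesis
    proof (cases "Y = {}")
      case False
      then obtain y where "y \<in> Y" by blast
      then have "Y = {y}" using unique by blast
      then show ?thesis using Ints \<open>y \<in> Y\<close> by blast
    qed simp
  qed
  show ?thesis
    unfolding implied_fixed_integer_def Let_def using fixed by blast
qed

end
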